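(* The diagram $\mathbf{E}_7^{(2)}$ has exactly $4$ orbits of labelings: 1. the orbit of zero, consisting of the labelings with $1$ or $3$ or $5$ components (including the component of the boxed 1), excluding the fixed labeling $\ell'_2$; 2. the fixed labeling $\ell'_1$ with $a_1=1$ and all other $a_i=0$; 3. the fixed labeling $\ell'_2$ with $a_3=a_7=1$ and all other $a_i=0$; 4. the orbit consisting of the labelings with $2$ or $4$ components (including the component of the boxed 1), excluding the fixed labeling $\ell'_1$, with representative the labeling $\ell'_3$ with $a_1=a_3=a_7=1$ and all other $a_i=0$.
   Context: $\mathbf{E}_7^{(2)}$ is the Dynkin diagram $\mathbf{E}_7$ with vertices $1,\dots,7$, edges $\{1,2\},\{2,3\},\{3,4\},\{4,5\},\{5,6\},\{4,7\}$, with vertex $2$ colored black. A labeling is $\boldsymbol a=(a_1,\dots,a_7)\in(\mathbb{Z}/2\mathbb{Z})^7$. The augmented diagram is obtained by adding one extra vertex (the "boxed 1"), joined by an edge to vertex $2$ only, carrying the constant label $1$. For $1\le i\le 7$ the move $\mathcal{M}_i$ changes only $a_i$, replacing it by $a_i$ plus the sum (in $\mathbb{Z}/2\mathbb{Z}$) of the labels of all neighbors of $i$ in the augmented diagram (including the boxed 1 when $i=2$). There is no move at the boxed vertex. Orbits are the equivalence classes of labelings under finite sequences of moves; a fixed labeling is one fixed by all moves (so it forms an orbit by itself). Components of a labeling are the connected components of the subgraph of the augmented diagram induced on the vertices with label $1$, the boxed vertex included. *)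

theory Defs
  imports Main "HOL-Library.Z2"
begin

datatype vertex = V1 | V2 | V3 | V4 | V5 | V6 | V7

text \<open>Vertices of the augmented diagram; \<open>Boxed\<close> is the extra vertex with constant label 1.\<close>

datatype aug_vertex = Node vertex | Boxed

definition E7_edges :: "vertex set set" where
  "E7_edges = {{V1, V2}, {V2, V3}, {V3, V4}, {V4, V5}, {V5, V6}, {V4, V7}}"

text \<open>\<open>V2\<close> is the black vertex, hence the only one joined to the boxed vertex.\<close>

definition aug_edges :: "aug_vertex set set" where
  "aug_edges = (\<lambda>e. Node ` e) ` E7_edges \<union> {{Boxed, Node V2}}"

definition neighbors :: "aug_vertex \<Rightarrow> aug_vertex set" where
  "neighbors x = {y. {x, y} \<in> aug_edges}"

text \<open>The type \<open>bit\<close> is the field with two elements.\<close>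

type_synonym labeling = "vertex \<Rightarrow> bit"

primrec aug_label :: "labeling \<Rightarrow> aug_vertex \<Rightarrow> bit" where
  "aug_label a (Node v) = a v"
| "aug_label a Boxed = 1"

definition move :: "vertex \<Rightarrow> labeling \<Rightarrow> labeling" where
  "move i a = a(i := a i + (\<Sum>y\<in>neighbors (Node i). aug_label a y))"

definition fixed_labeling :: "labeling \<Rightarrow> bool" where
  "fixed_labeling a \<longleftrightarrow> (\<forall>i. move i a = a)"

definition move_equiv :: "(labeling \<times> labeling) set" where
  "move_equiv = {(a, b). \<exists>i. b = move i a}\<^sup>*"

definition orbit :: "labeling \<Rightarrow> labeling set" where
  "orbit a = move_equiv `` {a}"

definition orbits :: "labeling set set" where
  "orbits = UNIV // move_equiv"

definition support :: "labeling \<Rightarrow> aug_vertex set" where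
  "support a = {x. aug_label a x = 1}"

definition induced_adj :: "labeling \<Rightarrow> (aug_vertex \<times> aug_vertex) set" where
  "induced_adj a = {(x, y). x \<in> support a \<and> y \<in> support a \<and> {x, y} \<in> aug_edges}"

text \<open>Connected components are represented by their vertex sets, i.e. by the classes of
  the relation of being joined by a path inside the induced subgraph.\<close>

definition components :: "labeling \<Rightarrow> aug_vertex set set" where
  "components a = support a // ((induced_adj a)\<^sup>* \<inter> support a \<times> support a)"

definition num_components :: "labeling \<Rightarrow> nat" where
  "num_components a = card (components a)"

definition zero_labeling :: labeling where
  "zero_labeling = (\<lambda>_. 0)"

definition ell1 :: labeling where
  "ell1 = zero_labeling(V1 := 1)"

definition ell2 :: labeling where
  "ell2 = zero_labeling(V3 := 1, V7 := 1)"

definition ell3 :: labeling where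
  "ell3 = zero_labeling(V1 := 1, V3 := 1, V7 := 1)"

text \<open>Since a vertex is not its own neighbor, moves are involutions; so finite sequences of
  moves do define an equivalence relation.\<close>

lemma not_self_neighbor: "x \<notin> neighbors x"
  by (cases x) (auto simp: neighbors_def aug_edges_def E7_edges_def doubleton_eq_iff)

lemma move_involution: "move i (move i a) = a"
proof -
  have "aug_label (move i a) y = aug_label a y" if "y \<in> neighbors (Node i)" for y
    using that not_self_neighbor[of "Node i"] by (cases y) (auto simp: move_def)
  then have "(\<Sum>y\<in>neighbors (Node i). aug_label (move i a) y)
      = (\<Sum>y\<in>neighbors (Node i). aug_label a y)"
    by (intro sum.cong) auto
  then have "move i (move i a) = (move i a)(i := move i a i
      + (\<Sum>y\<in>neighbors (Node i). aug_label a y))"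
    by (simp only: move_def[of i "move i a"])
  moreover have "x + s + s = x" for x s :: bit
    by (cases x; cases s) simp_all
  ultimately show ?thesis
    unfolding move_def[of i a] by (metis fun_upd_same fun_upd_triv fun_upd_upd)
qed

lemma equiv_move_equiv: "equiv UNIV move_equiv"
proof (rule equivI)
  have "sym {(a, b). \<exists>i. b = move i a}"
    by (rule symI) (auto intro: move_involution[symmetric])
  then show "sym move_equiv"
    unfolding move_equiv_def by (rule sym_rtrancl)
qed (auto simp: move_equiv_def refl_rtrancl trans_rtrancl)

end

theory Submission
  imports Defs
begin

text \<open>
  The augmented diagram is a tree. Rooting it at \<open>Boxed\<close>, every component of a labeling has a unique
  topmost vertex, so components are counted by the labeled vertices whose parent is unlabeled; the
  parity of this number is invariant under moves. Conversely, moves that switch a label off lead to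
  a labeling in which the labeled vertices are pairwise non-adjacent and \<open>V2\<close> is unlabeled. Among
  these 28 labelings, an isolated 1 slides along an edge, a 1 at the trivalent vertex \<open>V4\<close> is
  exchanged for 1s at its three neighbors, and the same exchange at \<open>V2\<close>, whose boxed neighbor is
  always labeled, trades the empty set for 1s at \<open>V1\<close> and \<open>V3\<close>.
\<close>

section \<open>Counting components\<close>

primrec parent :: "vertex \<Rightarrow> aug_vertex" where
  "parent V1 = Node V2"
| "parent V2 = Boxed"
| "parent V3 = Node V2"
| "parent V4 = Node V3"
| "parent V5 = Node V4"
| "parent V6 = Node V5"
| "parent V7 = Node V4"

text \<open>Distance from \<open>Boxed\<close>; it makes the climb in \<open>component_root\<close>
  terminate.\<close>

primrec depth :: "vertex \<Rightarrow> nat" where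
  "depth V1 = 2"
| "depth V2 = 1"
| "depth V3 = 2"
| "depth V4 = 3"
| "depth V5 = 4"
| "depth V6 = 5"
| "depth V7 = 4"

lemma depth_parent: "parent v = Node w \<Longrightarrow> depth w < depth v"
  by (cases v) auto

lemma depth_pos: "0 < depth v"
  by (cases v) auto

lemma UNIV_vertex: "UNIV = {V1, V2, V3, V4, V5, V6, V7}"
  using vertex.exhaust by auto

lemma finite_vertex [simp]: "finite (A :: vertex set)"
  by (rule finite_subset[OF subset_UNIV]) (simp add: UNIV_vertex)

lemma aug_edges_eq: "aug_edges = range (\<lambda>v. {Node v, parent v})"
  by (auto simp: aug_edges_def E7_edges_def UNIV_vertex insert_commute)

text \<open>Climbs as long as the parent is labeled. The label of the argument itself is not tested,
  so the value is the top of a component only for arguments in the support.\<close>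

function component_root :: "labeling \<Rightarrow> aug_vertex \<Rightarrow> aug_vertex" where
  "component_root a Boxed = Boxed"
| "component_root a (Node v) =
    (if aug_label a (parent v) = 1 then component_root a (parent v) else Node v)"
  by pat_completeness auto
termination
  by (relation "measure (\<lambda>(a, x). case x of Boxed \<Rightarrow> 0 | Node v \<Rightarrow> depth v)")
    (auto split: aug_vertex.split simp: depth_parent depth_pos)

definition top_vertices :: "labeling \<Rightarrow> aug_vertex set" where
  "top_vertices a = insert Boxed (Node ` {v. a v = 1 \<and> aug_label a (parent v) = 0})"

lemma component_root_top: "x \<in> top_vertices a \<Longrightarrow> component_root a x = x"
  by (auto simp: top_vertices_def)

lemma top_vertices_subset: "top_vertices a \<subseteq> support a"
  by (auto simp: top_vertices_def support_def)

lemma component_root_in_top: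
  "x \<in> support a \<Longrightarrow> component_root a x \<in> top_vertices a \<and> (x, component_root a x) \<in> (induced_adj a)\<^sup>*"
proof (induction a x rule: component_root.induct)
  case (1 a)
  then show ?case by (simp add: top_vertices_def)
next
  case (2 a v)
  show ?case
  proof (cases "aug_label a (parent v) = 1")
    case True
    then have "(Node v, parent v) \<in> induced_adj a"
      using 2 by (auto simp: induced_adj_def aug_edges_eq support_def)
    then show ?thesis
      using 2 True by (auto simp: support_def intro: converse_rtrancl_into_rtrancl)
  next
    case False
    then show ?thesis
      using 2 by (auto simp: top_vertices_def support_def)
  qed
qed

text \<open>Every edge joins a vertex to its parent; when both are labeled, the climb from the child
  passes through the parent.\<close>

lemma component_root_adj:
  assumes "(x, y) \<in> induced_adj a"
  shows "component_root a x = component_root a y"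
proof -
  obtain v where "{x, y} = {Node v, parent v}"
    using assms by (auto simp: induced_adj_def aug_edges_eq)
  then show ?thesis
    using assms by (auto simp: doubleton_eq_iff induced_adj_def support_def)
qed

lemma component_root_connected:
  "(x, y) \<in> (induced_adj a)\<^sup>* \<Longrightarrow> component_root a x = component_root a y"
  by (induction rule: rtrancl_induct) (auto dest: component_root_adj)

text \<open>On the support, \<open>component_root\<close> is constant on components, stays inside
  them and fixes exactly the top vertices, so these form a transversal of the components.\<close>

lemma num_components_eq_card_top: "num_components a = card (top_vertices a)"
proof -
  define R where "R = (induced_adj a)\<^sup>* \<inter> support a \<times> support a"
  have "sym (induced_adj a)"
    by (auto simp: sym_def induced_adj_def insert_commute)
  then have sym: "(y, x) \<in> (induced_adj a)\<^sup>*" if "(x, y) \<in> (induced_adj a)\<^sup>*" for x y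
    using that by (meson sym_rtrancl symD)
  \<comment> \<open>If the roots agree, the path from \<open>x\<close> up to the root is continued
    by the reversed path from \<open>y\<close>.\<close>
  have R_iff: "(x, y) \<in> R \<longleftrightarrow>
      x \<in> support a \<and> y \<in> support a \<and> component_root a x = component_root a y" for x y
    unfolding R_def
    using component_root_connected[of x y a] component_root_in_top[of x a]
      component_root_in_top[of y a] sym
    by (auto intro: rtrancl_trans)
  have "bij_betw (\<lambda>x. R `` {x}) (top_vertices a) (support a // R)"
  proof (intro bij_betwI')
    fix x y
    assume "x \<in> top_vertices a" "y \<in> top_vertices a"
    then show "(R `` {x} = R `` {y}) = (x = y)"
      using component_root_top[of x a] component_root_top[of y a] top_vertices_subset[of a]
      by (auto simp: R_iff set_eq_iff)
  next
    fix x
    assume "x \<in> top_vertices a"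
    then show "R `` {x} \<in> support a // R"
      using top_vertices_subset by (auto intro: quotientI)
  next
    fix X
    assume "X \<in> support a // R"
    then obtain x where x: "x \<in> support a" "X = R `` {x}"
      by (auto elim: quotientE)
    then have "X = R `` {component_root a x}"
      using component_root_in_top[of x a] component_root_top[of "component_root a x" a]
        top_vertices_subset[of a] by (auto simp: R_iff)
    then show "\<exists>t\<in>top_vertices a. X = R `` {t}"
      using component_root_in_top[of x a] x by blast
  qed
  then show ?thesis
    by (simp add: num_components_def components_def R_def bij_betw_same_card)
qed

lemma num_components_eq_sum:
  "num_components a = 1 + (\<Sum>v\<in>UNIV. of_bool (a v = 1 \<and> aug_label a (parent v) = 0))"
proof -
  have "card (top_vertices a) = 1 + card {v. a v = 1 \<and> aug_label a (parent v) = 0}"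
    unfolding top_vertices_def by (subst card_insert_disjoint) (auto simp: card_image inj_on_def)
  then show ?thesis
    by (simp add: num_components_eq_card_top sum_of_bool_eq)
qed

section \<open>Labelings in coordinates\<close>

definition lab :: "bit \<Rightarrow> bit \<Rightarrow> bit \<Rightarrow> bit \<Rightarrow> bit \<Rightarrow> bit \<Rightarrow> bit \<Rightarrow> labeling" where
  "lab a b c d e f g = rec_vertex a b c d e f g"

lemma lab_simps [simp]:
  "lab a b c d e f g V1 = a" "lab a b c d e f g V2 = b" "lab a b c d e f g V3 = c"
  "lab a b c d e f g V4 = d" "lab a b c d e f g V5 = e" "lab a b c d e f g V6 = f"
  "lab a b c d e f g V7 = g"
  by (simp_all add: lab_def)

lemma labeling_eq_iff:
  fixes a b :: labeling
  shows "a = b \<longleftrightarrow> a V1 = b V1 \<and> a V2 = b V2 \<and> a V3 = b V3 \<and> a V4 = b V4 \<and>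
    a V5 = b V5 \<and> a V6 = b V6 \<and> a V7 = b V7"
proof (intro iffI ext)
  fix v
  assume "a V1 = b V1 \<and> a V2 = b V2 \<and> a V3 = b V3 \<and> a V4 = b V4 \<and>
    a V5 = b V5 \<and> a V6 = b V6 \<and> a V7 = b V7"
  then show "a v = b v"
    by (cases v) simp_all
qed simp

lemma labeling_cases:
  obtains (lab) a b c d e f g where "l = lab a b c d e f g"
  by (rule that[of "l V1" "l V2" "l V3" "l V4" "l V5" "l V6" "l V7"]) (simp add: labeling_eq_iff)

lemma neighbors_simps:
  "neighbors (Node V1) = {Node V2}"
  "neighbors (Node V2) = {Node V1, Node V3, Boxed}"
  "neighbors (Node V3) = {Node V2, Node V4}"
  "neighbors (Node V4) = {Node V3, Node V5, Node V7}"
  "neighbors (Node V5) = {Node V4, Node V6}"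
  "neighbors (Node V6) = {Node V5}"
  "neighbors (Node V7) = {Node V4}"
  by (auto simp: neighbors_def aug_edges_def E7_edges_def doubleton_eq_iff)

text \<open>The summand 1 in the rule for \<open>V2\<close> is the label of
  \<open>Boxed\<close>.\<close>

lemma move_lab [simp]:
  "move V1 (lab a b c d e f g) = lab (a + b) b c d e f g"
  "move V2 (lab a b c d e f g) = lab a (b + (a + (c + 1))) c d e f g"
  "move V3 (lab a b c d e f g) = lab a b (c + (b + d)) d e f g"
  "move V4 (lab a b c d e f g) = lab a b c (d + (c + (e + g))) e f g"
  "move V5 (lab a b c d e f g) = lab a b c d (e + (d + f)) f g"
  "move V6 (lab a b c d e f g) = lab a b c d e (f + e) g"
  "move V7 (lab a b c d e f g) = lab a b c d e f (g + d)"
  by (simp_all add: labeling_eq_iff move_def neighbors_simps)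

lemma lab_eq_iff [simp]:
  "lab a b c d e f g = lab a' b' c' d' e' f' g' \<longleftrightarrow>
    a = a' \<and> b = b' \<and> c = c' \<and> d = d' \<and> e = e' \<and> f = f' \<and> g = g'"
  by (simp add: labeling_eq_iff)

lemma representatives_lab:
  "zero_labeling = lab 0 0 0 0 0 0 0"
  "ell1 = lab 1 0 0 0 0 0 0"
  "ell2 = lab 0 0 1 0 0 0 1"
  "ell3 = lab 1 0 1 0 0 0 1"
  by (simp_all add: labeling_eq_iff zero_labeling_def ell1_def ell2_def ell3_def)

text \<open>The leading 1 counts the component of \<open>Boxed\<close>. There is no term for
  \<open>V2\<close>, whose parent \<open>Boxed\<close> is always labeled.\<close>

lemma num_components_lab:
  "num_components (lab a b c d e f g) = 1 + (of_bool (a = 1 \<and> b = 0) + of_bool (c = 1 \<and> b = 0) +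
    of_bool (d = 1 \<and> c = 0) + of_bool (e = 1 \<and> d = 0) + of_bool (f = 1 \<and> e = 0) +
    of_bool (g = 1 \<and> d = 0))"
  by (simp add: num_components_eq_sum UNIV_vertex)

text \<open>At most four of the six indicators are 1: those of \<open>c\<close> and \<open>d\<close>
  exclude each other, and so do those of \<open>e\<close> and \<open>f\<close>.\<close>

lemma num_components_bounds: "num_components l \<in> {1..5}"
proof (cases l rule: labeling_cases)
  case (lab a b c d e f g)
  then show ?thesis
    by (auto simp: num_components_lab of_bool_def)
qed

text \<open>In a tree, switching on a vertex with \<open>k\<close> labeled neighbors changes the
  number of components by \<open>1 - k\<close>. A move switches a label on or off only if
  \<open>k\<close> is odd, so the change is even.\<close>

lemma even_num_components_move: "even (num_components (move i l)) \<longleftrightarrow> even (num_components l)"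
proof (cases l rule: labeling_cases)
  case (lab a b c d e f g)
  then show ?thesis
  proof (cases i)
    case V1 then show ?thesis unfolding lab
      by (cases a; cases b; simp add: num_components_lab)
  next
    case V2 then show ?thesis unfolding lab
      by (cases a; cases b; cases c; simp add: num_components_lab)
  next
    case V3 then show ?thesis unfolding lab
      by (cases b; cases c; cases d; simp add: num_components_lab)
  next
    case V4 then show ?thesis unfolding lab
      by (cases c; cases d; cases e; cases g; simp add: num_components_lab)
  next
    case V5 then show ?thesis unfolding lab
      by (cases d; cases e; cases f; simp add: num_components_lab)
  next
    case V6 then show ?thesis unfolding lab
      by (cases e; cases f; simp add: num_components_lab)
  next
    case V7 then show ?thesis unfolding lab
      by (cases d; cases g; simp add: num_components_lab)
  qed
qed

section \<open>Orbits\<close>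

lemma orbit_eq_iff: "orbit a = orbit b \<longleftrightarrow> (a, b) \<in> move_equiv"
  unfolding orbit_def using equiv_move_equiv by (simp add: eq_equiv_class_iff)

lemma mem_orbit_iff: "b \<in> orbit a \<longleftrightarrow> orbit b = orbit a"
  using orbit_eq_iff[of a b] by (auto simp: orbit_def)

lemma orbit_move [simp]: "orbit (move i a) = orbit a"
proof -
  have "(a, move i a) \<in> move_equiv"
    by (auto simp: move_equiv_def)
  then show ?thesis
    by (simp add: orbit_eq_iff[symmetric])
qed

lemma orbit_fold_move: "orbit (fold move is a) = orbit a"
  by (induction "is" arbitrary: a) simp_all

lemma move_equiv_invariant:
  assumes "(a, b) \<in> move_equiv" and "\<And>i c. P c \<Longrightarrow> P (move i c)" and "P a"
  shows "P b"
  using assms(1,3) unfolding move_equiv_def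
  by (induction rule: rtrancl_induct) (auto intro: assms(2))

lemma orbit_fixed: "fixed_labeling a \<Longrightarrow> orbit a = {a}"
  using move_equiv_invariant[of a _ "\<lambda>c. c = a"]
  by (auto simp: orbit_def fixed_labeling_def move_equiv_def)

lemma orbit_eq_even_num_components:
  assumes "orbit a = orbit b"
  shows "even (num_components a) \<longleftrightarrow> even (num_components b)"
  using move_equiv_invariant[of a b "\<lambda>c. even (num_components c) \<longleftrightarrow> even (num_components a)"] assms
  by (simp add: orbit_eq_iff even_num_components_move)

text \<open>Fixed means that every vertex has an even number of labeled neighbors. Here only
  \<open>V2\<close> has any, namely \<open>V1\<close> and \<open>Boxed\<close>.\<close>

lemma fixed_ell1: "fixed_labeling ell1"
  unfolding fixed_labeling_def representatives_lab
  by (intro allI; case_tac i; simp)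

text \<open>Only \<open>V2\<close> and \<open>V4\<close> have labeled neighbors: \<open>V3\<close>
  and \<open>Boxed\<close>, respectively \<open>V3\<close> and \<open>V7\<close>.\<close>

lemma fixed_ell2: "fixed_labeling ell2"
  unfolding fixed_labeling_def representatives_lab
  by (intro allI; case_tac i; simp)

section \<open>Reduction to representatives\<close>

text \<open>Each move that switches a label off lowers the number of 1s. In the end every labeled
  vertex has an even number of labeled neighbors; as a tree with an edge has at least two leaves,
  one of them not \<open>Boxed\<close>, all components are then single vertices.\<close>

lemma orbit_locally_minimal:
  "\<exists>b. orbit b = orbit a \<and> (\<forall>i. b i = 1 \<longrightarrow> move i b i = 1)"
proof (induction "card {i. a i = 1}" arbitrary: a rule: less_induct)
  case less
  show ?case
  proof (cases "\<forall>i. a i = 1 \<longrightarrow> move i a i = 1")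
    case False
    then obtain i where "a i = 1" "move i a i \<noteq> 1"
      by blast
    then have "{j. move i a j = 1} \<subset> {j. a j = 1}"
      by (auto simp: move_def split: if_splits)
    then have "card {j. move i a j = 1} < card {j. a j = 1}"
      by (simp add: psubset_card_mono)
    then show ?thesis
      using less[of "move i a"] by simp
  qed auto
qed

text \<open>A slide switches the target on and then the source off; the zeros ensure that neither
  end has another labeled neighbor.\<close>

lemma slide_6_5: "orbit (lab a 0 c 0 0 1 g) = orbit (lab a 0 c 0 1 0 g)"
  using orbit_fold_move[of "[V5, V6]" "lab a 0 c 0 0 1 g"] by simp

lemma slide_5_4: "orbit (lab a 0 0 0 1 0 0) = orbit (lab a 0 0 1 0 0 0)"
  using orbit_fold_move[of "[V4, V5]" "lab a 0 0 0 1 0 0"] by simp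

lemma slide_7_4: "orbit (lab a 0 0 0 0 f 1) = orbit (lab a 0 0 1 0 f 0)"
  using orbit_fold_move[of "[V4, V7]" "lab a 0 0 0 0 f 1"] by simp

lemma slide_3_4: "orbit (lab a 0 1 0 0 f 0) = orbit (lab a 0 0 1 0 f 0)"
  using orbit_fold_move[of "[V4, V3]" "lab a 0 1 0 0 f 0"] by simp

lemma exchange_at_4: "orbit (lab a 0 1 0 1 0 1) = orbit (lab a 0 0 1 0 0 0)"
  using orbit_fold_move[of "[V4, V3, V5, V7]" "lab a 0 1 0 1 0 1"] by simp

text \<open>With three labeled neighbors \<open>V2\<close> switches on, then clears
  \<open>V1\<close> and \<open>V3\<close>, and is finally switched off by \<open>Boxed\<close>
  alone.\<close>

lemma exchange_at_2: "orbit (lab 1 0 1 0 e f g) = orbit (lab 0 0 0 0 e f g)"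
  using orbit_fold_move[of "[V2, V1, V3, V2]" "lab 1 0 1 0 e f g"] by simp

text \<open>If \<open>V1\<close> is unlabeled, the 1 slides to \<open>V7\<close> and the reversed
  exchange at \<open>V2\<close> gives \<open>ell3\<close>. Otherwise it slides to \<open>V3\<close>,
  where the exchange removes it together with \<open>V1\<close>.\<close>

lemma orbit_one:
  "orbit (lab 0 0 0 1 0 0 0) = orbit ell3"
  "orbit (lab 1 0 0 1 0 0 0) = orbit zero_labeling"
  using exchange_at_2[of 0 0 1] exchange_at_2[of 0 0 0] slide_7_4[of 0 0] slide_3_4[of 1 0]
  by (simp_all add: representatives_lab)

text \<open>If \<open>V1\<close> is unlabeled, slide \<open>V4\<close> to \<open>V7\<close>, create
  1s at \<open>V1\<close> and \<open>V3\<close>, slide \<open>V6\<close> to \<open>V5\<close> and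
  merge \<open>V3\<close>, \<open>V5\<close>, \<open>V7\<close> into \<open>V4\<close>. Otherwise
  slide \<open>V4\<close> to \<open>V3\<close>, cancel it with \<open>V1\<close> and bring the 1 at
  \<open>V6\<close> to \<open>V4\<close>.\<close>

lemma orbit_two:
  "orbit (lab 0 0 0 1 0 1 0) = orbit zero_labeling"
  "orbit (lab 1 0 0 1 0 1 0) = orbit ell3"
  using exchange_at_2[of 0 1 1] exchange_at_2[of 0 1 0] slide_7_4[of 0 1] slide_3_4[of 1 1]
    slide_6_5[of 1 1 1] exchange_at_4[of 1] slide_6_5[of 0 0 0] slide_5_4[of 0] orbit_one
  by simp_all

lemma orbit_representatives:
  "orbit l \<in> {orbit zero_labeling, orbit ell1, orbit ell2, orbit ell3}"
proof -
  obtain m where m: "orbit m = orbit l" "\<And>i. m i = 1 \<longrightarrow> move i m i = 1"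
    using orbit_locally_minimal by metis
  note rules = slide_6_5 slide_5_4 slide_7_4 slide_3_4 exchange_at_4 orbit_one orbit_two
  \<comment> \<open>The 1 at \<open>V5\<close> must retreat to \<open>V6\<close> before the other
    can reach \<open>V4\<close>. This runs against the orientation of \<open>slide_6_5\<close> as a
    rewrite rule, so it is supplied separately.\<close>
  have pairs: "orbit (lab a 0 1 0 1 0 0) = orbit (lab a 0 0 1 0 1 0)"
    "orbit (lab a 0 0 0 1 0 1) = orbit (lab a 0 0 1 0 1 0)" for a
    using slide_6_5[of a 1 0] slide_3_4[of a 1] slide_6_5[of a 0 1] slide_7_4[of a 1] by simp_all
  show ?thesis
  proof (cases m rule: labeling_cases)
    case (lab a b c d e f g)
    have "orbit (lab a b c d e f g) \<in> {orbit zero_labeling, orbit ell1, orbit ell2, orbit ell3}"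
      using m(2)[of V1] m(2)[of V2] m(2)[of V3] m(2)[of V4] m(2)[of V5] m(2)[of V6] m(2)[of V7]
      unfolding lab
      \<comment> \<open>Local minimality discards all but 28 cases. The first pass rewrites along
        slides and exchanges; the labelings left are the representatives themselves, which the
        second pass recognizes.\<close>
      by (cases a; cases b; cases c; cases d; cases e; cases f; cases g)
        (simp_all add: rules pairs, simp_all add: representatives_lab)
    then show ?thesis
      using m(1) lab by simp
  qed
qed

section \<open>The orbits as parity classes\<close>

lemma num_components_representatives:
  "num_components zero_labeling = 1" "num_components ell1 = 2"
  "num_components ell2 = 3" "num_components ell3 = 4"
  by (simp_all add: representatives_lab num_components_lab)

lemma orbit_eq_fixed_iff: "fixed_labeling b \<Longrightarrow> orbit a = orbit b \<longleftrightarrow> a = b"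
  using orbit_fixed[of b] mem_orbit_iff[of a b] by auto

text \<open>Of the four candidate orbits for an odd labeling, parity excludes those of
  \<open>ell1\<close> and \<open>ell3\<close>, and the orbit of \<open>ell2\<close> is a
  singleton.\<close>

lemma orbit_zero_labeling: "orbit zero_labeling = {a. odd (num_components a)} - {ell2}"
proof (intro set_eqI)
  fix a
  have "zero_labeling \<noteq> ell2"
    by (simp add: representatives_lab)
  then show "a \<in> orbit zero_labeling \<longleftrightarrow> a \<in> {a. odd (num_components a)} - {ell2}"
    using orbit_representatives[of a] orbit_eq_even_num_components[of a zero_labeling]
      orbit_eq_even_num_components[of a ell1] orbit_eq_even_num_components[of a ell3]
      orbit_eq_fixed_iff[OF fixed_ell2, of a] orbit_eq_fixed_iff[OF fixed_ell2, of zero_labeling]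
    by (auto simp: mem_orbit_iff num_components_representatives)
qed

lemma orbit_ell3: "orbit ell3 = {a. even (num_components a)} - {ell1}"
proof (intro set_eqI)
  fix a
  have "ell3 \<noteq> ell1"
    by (simp add: representatives_lab)
  then show "a \<in> orbit ell3 \<longleftrightarrow> a \<in> {a. even (num_components a)} - {ell1}"
    using orbit_representatives[of a] orbit_eq_even_num_components[of a ell3]
      orbit_eq_even_num_components[of a ell2] orbit_eq_even_num_components[of a zero_labeling]
      orbit_eq_fixed_iff[OF fixed_ell1, of a] orbit_eq_fixed_iff[OF fixed_ell1, of ell3]
    by (auto simp: mem_orbit_iff num_components_representatives)
qed

lemma num_components_parity:
  "odd (num_components a) \<longleftrightarrow> num_components a \<in> {1, 3, 5}"
  "even (num_components a) \<longleftrightarrow> num_components a \<in> {2, 4}"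
proof -
  have "num_components a \<in> {1, 2, 3, 4, 5}"
    using num_components_bounds[of a] by auto
  then show "odd (num_components a) \<longleftrightarrow> num_components a \<in> {1, 3, 5}"
    "even (num_components a) \<longleftrightarrow> num_components a \<in> {2, 4}"
    by auto
qed

theorem proposition12p4:
  shows "card orbits = 4 \<and>
    orbits = {orbit zero_labeling, {ell1}, {ell2}, orbit ell3} \<and>
    orbit zero_labeling = {a. num_components a \<in> {1, 3, 5}} - {ell2} \<and>
    fixed_labeling ell1 \<and>
    fixed_labeling ell2 \<and>
    orbit ell3 = {a. num_components a \<in> {2, 4}} - {ell1}"
proof -
  have "orbits = range orbit"
    by (auto simp: orbits_def quotient_def orbit_def)
  also have "\<dots> = {orbit zero_labeling, orbit ell1, orbit ell2, orbit ell3}"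
    using orbit_representatives by blast
  finally have orbits:
    "orbits = {orbit zero_labeling, {ell1}, {ell2}, orbit ell3}"
    by (simp add: orbit_fixed fixed_ell1 fixed_ell2)
  have mem: "zero_labeling \<in> orbit zero_labeling" "ell3 \<in> orbit ell3"
    by (simp_all add: mem_orbit_iff)
  have neq: "zero_labeling \<notin> {ell1, ell2}" "ell3 \<notin> {ell1, ell2}" "ell1 \<noteq> ell2"
    by (simp_all add: representatives_lab)
  \<comment> \<open>Parity separates the two large orbits: the component counts are 1 and 4.\<close>
  have "zero_labeling \<notin> orbit ell3"
    by (simp add: orbit_ell3 num_components_representatives)
  then have "orbit zero_labeling \<noteq> orbit ell3"
    using mem by auto
  moreover have "orbit zero_labeling \<noteq> {ell1}" "orbit zero_labeling \<noteq> {ell2}"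
    "{ell1} \<noteq> orbit ell3" "{ell2} \<noteq> orbit ell3"
    using mem neq by auto
  ultimately have "card orbits = 4"
    using neq by (simp add: orbits)
  then show ?thesis
    unfolding num_components_parity[symmetric]
    using orbits orbit_zero_labeling orbit_ell3 fixed_ell1 fixed_ell2 by blast
qed

end
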